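(* Let $d\in\mathbb N$, $a\in\mathbb N_0$. For all integers $n\ge m\ge0$, $$\widehat{S1p}(d,a;n,m)=\sum_{j=0}^{n-m}\binom{n-j}{m}\,S1p(n,n-j)\,a^{n-m-j}\,d^j=\sum_{j=m}^{n}\binom{j}{m}\,S1p(n,j)\,a^{j-m}\,d^{n-j},$$ where $S1p(n,j)$ denotes the usual unsigned Stirling numbers of the first kind.
   Context: $\mathbb N=\{1,2,\dots\}$, $\mathbb N_0=\{0,1,2,\dots\}$, $0^0:=1$. The generalized Stirling numbers of the second kind $S2(d,a;n,m)$, $0\le m\le n$, are defined by the operator identity $(a\,\mathbf 1+d\,\mathbf E_x)^n=\sum_{m=0}^n S2(d,a;n,m)\,x^m\,\mathbf d_x^{\,m}$, where $\mathbf d_x$ is differentiation with respect to $x$, $\mathbf E_x:=x\,\mathbf d_x$ and $\mathbf 1$ is the identity operator; $S2(d,a;n,m):=0$ for $m>n$. Let $\mathbf{S1}[d,a]=(S1(d,a;n,m))_{n,m\ge0}$ be the inverse of the infinite lower triangular matrix $\mathbf{S2}[d,a]=(S2(d,a;n,m))_{n,m\ge0}$, and set $\widehat{S1p}(d,a;n,m):=d^n\,(-1)^{n-m}\,S1(d,a;n,m)$. The usual unsigned Stirling numbers of the first kind satisfy $\prod_{i=0}^{n-1}(x+i)=\sum_{j=0}^n S1p(n,j)\,x^j$. *)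

theory Defs
  imports Complex_Main "HOL-Computational_Algebra.Polynomial" "HOL-Combinatorics.Stirling"
begin

text \<open>
  The differential operators act on polynomials in \<open>x\<close> over the rationals. This is a faithful
  representation of the algebra generated by \<open>x\<close> and \<open>d/dx\<close>, so an operator identity holds
  exactly if it holds on all polynomials. Rationals are needed because the entries of the
  inverse matrix below have denominators \<open>d^n\<close>.
\<close>

definition euler_op :: "rat poly \<Rightarrow> rat poly" where
  "euler_op p = [:0, 1:] * pderiv p"

definition lin_euler_op :: "nat \<Rightarrow> nat \<Rightarrow> rat poly \<Rightarrow> rat poly" where
  "lin_euler_op d a p = smult (of_nat a) p + smult (of_nat d) (euler_op p)"

definition S2 :: "nat \<Rightarrow> nat \<Rightarrow> nat \<Rightarrow> nat \<Rightarrow> rat" where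
  "S2 d a n = (THE c.
     (\<forall>m>n. c m = 0) \<and>
     (\<forall>p. (lin_euler_op d a ^^ n) p = (\<Sum>m\<le>n. smult (c m) ([:0, 1:] ^ m * (pderiv ^^ m) p))))"

definition lower_triangular :: "(nat \<Rightarrow> nat \<Rightarrow> rat) \<Rightarrow> bool" where
  "lower_triangular A \<longleftrightarrow> (\<forall>n m. n < m \<longrightarrow> A n m = 0)"

text \<open>
  If \<open>A\<close> is lower triangular, then the terms with \<open>k > n\<close> of the infinite sum defining the
  matrix product vanish, hence the finite summation range.
\<close>

definition lt_mult :: "(nat \<Rightarrow> nat \<Rightarrow> rat) \<Rightarrow> (nat \<Rightarrow> nat \<Rightarrow> rat) \<Rightarrow> nat \<Rightarrow> nat \<Rightarrow> rat" where
  "lt_mult A B n m = (\<Sum>k\<le>n. A n k * B k m)"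

definition id_matrix :: "nat \<Rightarrow> nat \<Rightarrow> rat" where
  "id_matrix n m = (if n = m then 1 else 0)"

definition lt_inverse :: "(nat \<Rightarrow> nat \<Rightarrow> rat) \<Rightarrow> nat \<Rightarrow> nat \<Rightarrow> rat" where
  "lt_inverse A = (THE B. lower_triangular B \<and> lt_mult A B = id_matrix \<and> lt_mult B A = id_matrix)"

definition S1 :: "nat \<Rightarrow> nat \<Rightarrow> nat \<Rightarrow> nat \<Rightarrow> rat" where
  "S1 d a = lt_inverse (S2 d a)"

definition S1p_hat :: "nat \<Rightarrow> nat \<Rightarrow> nat \<Rightarrow> nat \<Rightarrow> rat" where
  "S1p_hat d a n m = of_nat d ^ n * (-1) ^ (n - m) * S1 d a n m"

text \<open>
  The usual unsigned Stirling numbers of the first kind are \<^const>\<open>stirling\<close>; the generating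
  polynomial \<open>x (x + 1) \<dots> (x + n - 1)\<close> is the content of the library's \<open>stirling_pochhammer\<close>.
\<close>

end

theory Submission
  imports Defs
begin

text \<open>
  On \<open>x^k\<close> the operator \<open>a + d E\<close> acts as multiplication by \<open>a + d k\<close>, and
  \<open>E (x^m D^m) = m x^m D^m + x^(m+1) D^(m+1)\<close>, so the matrix \<open>S2\<close> satisfies
  \<open>S2(n+1,m) = (a + d m) S2(n,m) + d S2(n,m-1)\<close>. The claimed closed form \<open>T\<close> satisfies the dual
  recurrence \<open>T(n+1,m) = (a + d n) T(n,m) + T(n,m-1)\<close>, by Pascal's rule and the recurrence of the
  Stirling numbers. The two recurrences imply that \<open>(-1)^(n-m) T(n,m) / d^n\<close> is a two-sided inverse
  of \<open>S2\<close>.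
\<close>

section \<open>Normal ordering of the operator powers\<close>

primrec S2_rec :: "nat \<Rightarrow> nat \<Rightarrow> nat \<Rightarrow> nat \<Rightarrow> rat" where
  "S2_rec d a 0 m = of_bool (m = 0)"
| "S2_rec d a (Suc n) m = (of_nat a + of_nat d * of_nat m) * S2_rec d a n m +
     (case m of 0 \<Rightarrow> 0 | Suc l \<Rightarrow> of_nat d * S2_rec d a n l)"

lemma S2_rec_eq_0: "n < m \<Longrightarrow> S2_rec d a n m = 0"
  by (induction n arbitrary: m) (auto split: nat.split)

lemma lin_euler_op_add: "lin_euler_op d a (p + q) = lin_euler_op d a p + lin_euler_op d a q"
  by (simp add: lin_euler_op_def euler_op_def pderiv_add smult_add_right algebra_simps)

lemma lin_euler_op_smult: "lin_euler_op d a (smult c p) = smult c (lin_euler_op d a p)"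
  by (simp add: lin_euler_op_def euler_op_def pderiv_smult smult_add_right mult.commute)

lemma lin_euler_op_sum: "lin_euler_op d a (sum f A) = (\<Sum>i\<in>A. lin_euler_op d a (f i))"
proof (induction A rule: infinite_finite_induct)
  case (insert x F)
  then show ?case by (simp add: lin_euler_op_add)
qed (simp_all add: lin_euler_op_def euler_op_def)

text \<open>Product rule: differentiating x^m gives the same term back with factor \<open>m\<close>,
  differentiating the other factor raises both exponents by one.\<close>

lemma euler_op_basis:
  "euler_op ([:0, 1:] ^ m * (pderiv ^^ m) p) =
     smult (of_nat m) ([:0, 1:] ^ m * (pderiv ^^ m) p) + [:0, 1:] ^ Suc m * (pderiv ^^ Suc m) p"
proof (cases m)
  case 0
  then show ?thesis by (simp add: euler_op_def)
next
  case (Suc l)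
  have "pderiv [:0, 1 :: rat:] = 1"
    by (simp add: pderiv_pCons)
  then have "pderiv ([:0, 1 :: rat:] ^ Suc l) = smult (of_nat (Suc l)) ([:0, 1:] ^ l)"
    by (simp only: pderiv_power_Suc mult_1_right)
  then show ?thesis
    unfolding euler_op_def Suc pderiv_mult
    by (simp only: funpow.simps comp_def distrib_left power_Suc mult_smult_left mult_smult_right)
      (simp add: mult_ac del: mult_pCons_left mult_pCons_right)
qed

text \<open>Existence half of the \<open>THE\<close> in \<open>S2\<close>. By linearity the operator
  is applied to each x^m D^m of the previous expansion, and coefficients are collected.\<close>

lemma lin_euler_op_funpow:
  "(lin_euler_op d a ^^ n) p =
     (\<Sum>m\<le>n. smult (S2_rec d a n m) ([:0, 1:] ^ m * (pderiv ^^ m) p))"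
proof (induction n)
  case 0
  then show ?case by simp
next
  case (Suc n)
  define b where "b m = [:0, 1:] ^ m * (pderiv ^^ m) p" for m
  have step: "lin_euler_op d a (b m) =
      smult (of_nat a + of_nat d * of_nat m) (b m) + smult (of_nat d) (b (Suc m))" for m
    unfolding lin_euler_op_def b_def euler_op_basis
    by (simp only: smult_add_right smult_add_left smult_smult add.assoc)
  have "(\<Sum>m\<le>Suc n. smult (S2_rec d a (Suc n) m) (b m)) =
      (\<Sum>m\<le>Suc n. smult ((of_nat a + of_nat d * of_nat m) * S2_rec d a n m) (b m)) +
      (\<Sum>m\<le>Suc n. smult (case m of 0 \<Rightarrow> 0 | Suc l \<Rightarrow> of_nat d * S2_rec d a n l) (b m))"
    by (simp only: S2_rec.simps smult_add_left sum.distrib)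
  also have "(\<Sum>m\<le>Suc n. smult (case m of 0 \<Rightarrow> 0 | Suc l \<Rightarrow> of_nat d * S2_rec d a n l) (b m)) =
      (\<Sum>m\<le>n. smult (of_nat d * S2_rec d a n m) (b (Suc m)))"
    by (subst sum.atMost_Suc_shift) simp
  \<comment> \<open>The extra term \<open>m = Suc n\<close> vanishes, being above the diagonal in
    row \<open>n\<close>.\<close>
  also have "(\<Sum>m\<le>Suc n. smult ((of_nat a + of_nat d * of_nat m) * S2_rec d a n m) (b m)) =
      (\<Sum>m\<le>n. smult ((of_nat a + of_nat d * of_nat m) * S2_rec d a n m) (b m))"
    by (simp add: S2_rec_eq_0)
  also have "\<dots> + (\<Sum>m\<le>n. smult (of_nat d * S2_rec d a n m) (b (Suc m))) =
      (\<Sum>m\<le>n. smult (S2_rec d a n m) (lin_euler_op d a (b m)))"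
    by (simp add: step smult_add_right sum.distrib mult.commute)
  also have "\<dots> = (lin_euler_op d a ^^ Suc n) p"
    using Suc.IH by (simp add: lin_euler_op_sum lin_euler_op_smult b_def)
  finally show ?case by (simp only: b_def)
qed

text \<open>The Pochhammer symbol is the falling factorial k (k-1) ... (k-m+1) produced by
  \<open>m\<close> derivatives of x^k.\<close>

lemma coeff_x_power_higher_pderiv_monom:
  "coeff ([:0, 1:] ^ m * (pderiv ^^ m) (monom 1 k)) k =
     (if m \<le> k then pochhammer (of_nat (Suc (k - m))) m else (0 :: rat))"
proof -
  have "[:0, 1 :: rat:] ^ m = monom 1 m"
    by (simp add: monom_altdef)
  then show ?thesis
    by (auto simp: coeff_monom_mult coeff_higher_pderiv)
qed

text \<open>Comparing coefficients of \<open>x^k\<close> in the action on \<open>x^k\<close> determines the \<open>c k\<close> successively.\<close>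

lemma normal_ordered_coeffs_unique:
  fixes c c' :: "nat \<Rightarrow> rat"
  assumes "\<And>p. (\<Sum>m\<le>n. smult (c m) ([:0, 1:] ^ m * (pderiv ^^ m) p)) =
                (\<Sum>m\<le>n. smult (c' m) ([:0, 1:] ^ m * (pderiv ^^ m) p))"
    and "k \<le> n"
  shows "c k = c' k"
  using \<open>k \<le> n\<close>
proof (induction k rule: less_induct)
  case (less k)
  define w :: "nat \<Rightarrow> rat"
    where "w m = (if m \<le> k then pochhammer (of_nat (Suc (k - m))) m else 0)" for m
  \<comment> \<open>The linear system is triangular: only \<open>m \<le> k\<close> contributes, and
    the diagonal entry \<open>w k\<close> is k!.\<close>
  have split: "(\<Sum>m\<le>n. e m * w m) = (\<Sum>m<k. e m * w m) + e k * w k" for e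
  proof -
    have "(\<Sum>m\<le>n. e m * w m) = (\<Sum>m\<le>k. e m * w m)"
      using less.prems by (intro sum.mono_neutral_right) (auto simp: w_def)
    then show ?thesis
      by (simp add: lessThan_Suc_atMost[symmetric])
  qed
  have "(\<Sum>m\<le>n. c m * w m) = (\<Sum>m\<le>n. c' m * w m)"
    using arg_cong[OF assms(1)[of "monom 1 k"], of "\<lambda>q. coeff q k"]
    by (simp only: coeff_sum coeff_smult coeff_x_power_higher_pderiv_monom w_def)
  moreover have "(\<Sum>m<k. c m * w m) = (\<Sum>m<k. c' m * w m)"
    using less by (intro sum.cong) auto
  moreover have "w k \<noteq> 0"
    by (simp add: w_def pochhammer_fact[symmetric])
  ultimately show ?case
    by (simp add: split)
qed

text \<open>The operator identity fixes the entries up to \<open>n\<close> and the vanishing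
  condition fixes the others, so the \<open>THE\<close> picks out a single function.\<close>

lemma S2_eq_S2_rec: "S2 d a = S2_rec d a"
proof
  fix n
  show "S2 d a n = S2_rec d a n"
    unfolding S2_def
  proof (rule the_equality)
    fix c :: "nat \<Rightarrow> rat"
    assume c: "(\<forall>m>n. c m = 0) \<and>
      (\<forall>p. (lin_euler_op d a ^^ n) p = (\<Sum>m\<le>n. smult (c m) ([:0, 1:] ^ m * (pderiv ^^ m) p)))"
    have "c k = S2_rec d a n k" if "k \<le> n" for k
      using c that by (intro normal_ordered_coeffs_unique[where n = n]) (auto simp flip: lin_euler_op_funpow)
    with c show "c = S2_rec d a n"
      by (metis S2_rec_eq_0 ext linorder_not_less)
  qed (use S2_rec_eq_0 lin_euler_op_funpow in blast)
qed

section \<open>Products and inverses of lower triangular matrices\<close>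

lemma lt_mult_extend:
  assumes "lower_triangular A" "n \<le> N"
  shows "lt_mult A B n m = (\<Sum>k\<le>N. A n k * B k m)"
  unfolding lt_mult_def using assms
  by (intro sum.mono_neutral_left) (auto simp: lower_triangular_def)

text \<open>\<open>lt_mult_extend\<close> gives all inner sums the common range up to
  \<open>n\<close>; then the two finite sums can be swapped.\<close>

lemma lt_mult_assoc:
  assumes "lower_triangular A" "lower_triangular B"
  shows "lt_mult (lt_mult A B) C = lt_mult A (lt_mult B C)"
proof (intro ext)
  fix n m
  have "lt_mult A (lt_mult B C) n m = (\<Sum>k\<le>n. A n k * (\<Sum>l\<le>n. B k l * C l m))"
    by (simp add: lt_mult_def[of A] lt_mult_extend[OF assms(2)])
  also have "\<dots> = (\<Sum>l\<le>n. \<Sum>k\<le>n. A n k * B k l * C l m)"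
    by (subst sum.swap) (simp add: sum_distrib_left mult.assoc)
  also have "\<dots> = lt_mult (lt_mult A B) C n m"
    by (simp add: lt_mult_def sum_distrib_right)
  finally show "lt_mult (lt_mult A B) C n m = lt_mult A (lt_mult B C) n m" ..
qed

lemma lt_mult_id_right: "lower_triangular A \<Longrightarrow> lt_mult A id_matrix = A"
  by (intro ext) (auto simp: lt_mult_def id_matrix_def lower_triangular_def if_distrib cong: if_cong)

lemma lt_mult_id_left: "lt_mult id_matrix A = A"
  by (intro ext) (auto simp: lt_mult_def id_matrix_def if_distrib[of "\<lambda>x. x * _"] cong: if_cong)

text \<open>Uniqueness is the usual C = C (A B) = (C A) B = B.\<close>

lemma lt_inverse_eqI:
  assumes "lower_triangular A" "lower_triangular B"
    and "lt_mult A B = id_matrix" "lt_mult B A = id_matrix"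
  shows "lt_inverse A = B"
  unfolding lt_inverse_def
proof (rule the_equality)
  fix C
  assume C: "lower_triangular C \<and> lt_mult A C = id_matrix \<and> lt_mult C A = id_matrix"
  then have "C = lt_mult C (lt_mult A B)"
    using assms(3) by (simp add: lt_mult_id_right)
  also have "\<dots> = B"
    using C assms(1) by (simp add: lt_mult_assoc[symmetric] lt_mult_id_left)
  finally show "C = B" .
qed (use assms in blast)

section \<open>The closed form and its recurrence\<close>

definition S1p_sum :: "nat \<Rightarrow> nat \<Rightarrow> nat \<Rightarrow> nat \<Rightarrow> rat" where
  "S1p_sum d a n m = (\<Sum>j\<le>n. of_nat (j choose m) * of_nat (stirling n j) *
     of_nat a ^ (j - m) * of_nat d ^ (n - j))"

lemma S1p_sum_0: "S1p_sum d a 0 m = of_bool (m = 0)"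
  by (cases m) (simp_all add: S1p_sum_def)

lemma S1p_sum_eq_0: "n < m \<Longrightarrow> S1p_sum d a n m = 0"
  unfolding S1p_sum_def by (intro sum.neutral) auto

text \<open>In the Stirling recurrence the summand \<open>n * stirling n j\<close> yields the factor
  \<open>d n\<close>; the shifted summand yields, by Pascal's rule, the factor \<open>a\<close> and
  the entry at \<open>m - 1\<close>.\<close>

lemma S1p_sum_Suc:
  "S1p_sum d a (Suc n) m = (of_nat a + of_nat d * of_nat n) * S1p_sum d a n m +
     (case m of 0 \<Rightarrow> 0 | Suc l \<Rightarrow> S1p_sum d a n l)"
proof -
  \<comment> \<open>The exponent \<open>i\<close> of \<open>d\<close> is kept separate from
    \<open>j\<close>, so that Pascal's rule can change \<open>j\<close> alone.\<close>
  define g :: "nat \<Rightarrow> nat \<Rightarrow> rat"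
    where "g j i = of_nat (j choose m) * of_nat a ^ (j - m) * of_nat d ^ i" for j i
  have stir: "stirling (Suc n) j = n * stirling n j + (case j of 0 \<Rightarrow> 0 | Suc l \<Rightarrow> stirling n l)" for j
    by (cases j; cases n) auto
  have pascal: "g (Suc j) i = of_nat a * g j i +
      (case m of 0 \<Rightarrow> 0 | Suc l \<Rightarrow> of_nat (j choose l) * of_nat a ^ (j - l) * of_nat d ^ i)" for j i
  proof (cases m)
    case (Suc l)
    \<comment> \<open>If \<open>j < m\<close>, then \<open>j \<le> l\<close>: truncated subtraction
      makes the exponents of \<open>a\<close> zero, and \<open>g j i\<close> vanishes.\<close>
    show ?thesis
    proof (cases "m \<le> j")
      case True
      then have "Suc j - m = Suc (j - m)" "j - l = Suc (j - m)"
        using Suc by auto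
      then show ?thesis
        by (simp add: g_def Suc algebra_simps)
    qed (simp add: g_def Suc binomial_eq_0)
  qed (simp add: g_def)
  have "S1p_sum d a (Suc n) m = (\<Sum>j\<le>Suc n. of_nat (stirling (Suc n) j) * g j (Suc n - j))"
    unfolding S1p_sum_def g_def by (intro sum.cong) (simp_all only: mult_ac)
  also have "\<dots> = (\<Sum>j\<le>Suc n. of_nat (n * stirling n j) * g j (Suc n - j)) +
      (\<Sum>j\<le>Suc n. of_nat (case j of 0 \<Rightarrow> 0 | Suc l \<Rightarrow> stirling n l) * g j (Suc n - j))"
    by (simp only: stir of_nat_add distrib_right sum.distrib)
  also have "(\<Sum>j\<le>Suc n. of_nat (case j of 0 \<Rightarrow> 0 | Suc l \<Rightarrow> stirling n l) * g j (Suc n - j)) =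
      (\<Sum>j\<le>n. of_nat (stirling n j) * g (Suc j) (n - j))"
    by (subst sum.atMost_Suc_shift) simp
  also have "\<dots> = of_nat a * S1p_sum d a n m + (case m of 0 \<Rightarrow> 0 | Suc l \<Rightarrow> S1p_sum d a n l)"
    unfolding pascal
    by (cases m) (simp_all add: S1p_sum_def g_def sum_distrib_left distrib_left sum.distrib mult_ac)
  also have "(\<Sum>j\<le>Suc n. of_nat (n * stirling n j) * g j (Suc n - j)) =
      of_nat d * of_nat n * S1p_sum d a n m"
    by (simp add: S1p_sum_def g_def sum_distrib_left Suc_diff_le mult_ac)
  finally show ?thesis
    by (simp add: algebra_simps)
qed

text \<open>The sign has the parity of \<open>n - m\<close> but avoids truncated
  subtraction.\<close>

definition S1_closed :: "nat \<Rightarrow> nat \<Rightarrow> nat \<Rightarrow> nat \<Rightarrow> rat" where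
  "S1_closed d a n m = (-1) ^ (n + m) * S1p_sum d a n m / of_nat d ^ n"

lemma S1_closed_0: "S1_closed d a 0 m = of_bool (m = 0)"
  by (cases m) (simp_all add: S1_closed_def S1p_sum_0)

lemma S1_closed_Suc:
  assumes "d \<ge> 1"
  shows "of_nat d * S1_closed d a (Suc n) m + (of_nat a + of_nat d * of_nat n) * S1_closed d a n m =
    (case m of 0 \<Rightarrow> 0 | Suc l \<Rightarrow> S1_closed d a n l)"
  using assms by (cases m) (simp_all add: S1_closed_def S1p_sum_Suc field_simps)

section \<open>The two matrices are mutually inverse\<close>

lemma lower_triangular_S2_rec: "lower_triangular (S2_rec d a)"
  by (simp add: lower_triangular_def S2_rec_eq_0)

lemma lower_triangular_S1_closed: "lower_triangular (S1_closed d a)"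
  by (simp add: lower_triangular_def S1_closed_def S1p_sum_eq_0)

lemma S2_rec_mult_S1_closed:
  assumes "d \<ge> 1"
  shows "lt_mult (S2_rec d a) (S1_closed d a) = id_matrix"
proof (intro ext)
  fix n m
  let ?A = "S2_rec d a" and ?B = "S1_closed d a"
  show "lt_mult ?A ?B n m = id_matrix n m"
  proof (induction n arbitrary: m)
    case 0
    then show ?case by (simp add: lt_mult_def id_matrix_def S1_closed_0)
  next
    case (Suc n)
    have "lt_mult ?A ?B (Suc n) m =
        (\<Sum>k\<le>Suc n. (of_nat a + of_nat d * of_nat k) * ?A n k * ?B k m) +
        (\<Sum>k\<le>Suc n. (case k of 0 \<Rightarrow> 0 | Suc l \<Rightarrow> of_nat d * ?A n l) * ?B k m)"
      by (simp only: lt_mult_def S2_rec.simps distrib_right sum.distrib)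
    also have "(\<Sum>k\<le>Suc n. (case k of 0 \<Rightarrow> 0 | Suc l \<Rightarrow> of_nat d * ?A n l) * ?B k m) =
        (\<Sum>k\<le>n. of_nat d * ?A n k * ?B (Suc k) m)"
      by (subst sum.atMost_Suc_shift) simp
    also have "(\<Sum>k\<le>Suc n. (of_nat a + of_nat d * of_nat k) * ?A n k * ?B k m) =
        (\<Sum>k\<le>n. (of_nat a + of_nat d * of_nat k) * ?A n k * ?B k m)"
      by (simp add: S2_rec_eq_0)
    also have "\<dots> + (\<Sum>k\<le>n. of_nat d * ?A n k * ?B (Suc k) m) =
        (\<Sum>k\<le>n. ?A n k * (of_nat d * ?B (Suc k) m + (of_nat a + of_nat d * of_nat k) * ?B k m))"
      by (simp add: sum.distrib[symmetric] algebra_simps)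
    \<comment> \<open>The recurrence of \<open>S1_closed\<close> turns row \<open>n + 1\<close> into
      row \<open>n\<close> shifted by one column, which is also how the identity matrix
      behaves.\<close>
    also have "\<dots> = (case m of 0 \<Rightarrow> 0 | Suc l \<Rightarrow> lt_mult ?A ?B n l)"
      unfolding S1_closed_Suc[OF assms] by (cases m) (simp_all add: lt_mult_def)
    finally show ?case
      by (cases m) (simp_all add: Suc.IH id_matrix_def)
  qed
qed

lemma S1_closed_mult_S2_rec:
  assumes "d \<ge> 1"
  shows "lt_mult (S1_closed d a) (S2_rec d a) = id_matrix"
proof (intro ext)
  fix n m
  let ?A = "S2_rec d a" and ?B = "S1_closed d a"
  show "lt_mult ?B ?A n m = id_matrix n m"
  proof (induction n arbitrary: m)
    case 0
    then show ?case by (simp add: lt_mult_def id_matrix_def S1_closed_0)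
  next
    case (Suc n)
    let ?s = "of_nat a + of_nat d * of_nat n :: rat"
    have "of_nat d * lt_mult ?B ?A (Suc n) m + ?s * lt_mult ?B ?A n m =
        (\<Sum>k\<le>Suc n. (of_nat d * ?B (Suc n) k + ?s * ?B n k) * ?A k m)"
      \<comment> \<open>Row \<open>n\<close> is padded to the range of row \<open>n + 1\<close> so
        that the two sums combine.\<close>
      unfolding lt_mult_extend[OF lower_triangular_S1_closed le_SucI[OF order_refl[of n]]]
      by (simp only: lt_mult_def sum_distrib_left sum.distrib distrib_right mult.assoc)
    also have "\<dots> = (\<Sum>k\<le>n. ?B n k * ?A (Suc k) m)"
      unfolding S1_closed_Suc[OF assms] by (subst sum.atMost_Suc_shift) simp
    also have "\<dots> = (of_nat a + of_nat d * of_nat m) * lt_mult ?B ?A n m +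
        (case m of 0 \<Rightarrow> 0 | Suc l \<Rightarrow> of_nat d * lt_mult ?B ?A n l)"
      by (cases m) (simp_all add: lt_mult_def sum_distrib_left distrib_left sum.distrib mult_ac)
    \<comment> \<open>By induction row \<open>n\<close> is that of the identity, so the terms with
      factors \<open>a + d n\<close> and \<open>a + d m\<close> cancel: they are nonzero only if
      \<open>m = n\<close>.\<close>
    finally have "of_nat d * lt_mult ?B ?A (Suc n) m = of_nat d * id_matrix (Suc n) m"
      by (cases m) (auto simp: Suc.IH id_matrix_def split: if_splits)
    then show ?case
      using assms by simp
  qed
qed

section \<open>Identification of \<open>S1\<close> and the two sums\<close>

lemma S1_eq_S1_closed: "d \<ge> 1 \<Longrightarrow> S1 d a = S1_closed d a"
  unfolding S1_def S2_eq_S2_rec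
  by (intro lt_inverse_eqI lower_triangular_S2_rec lower_triangular_S1_closed
      S2_rec_mult_S1_closed S1_closed_mult_S2_rec)

lemma S1p_hat_eq_S1p_sum:
  assumes "d \<ge> 1" "m \<le> n"
  shows "S1p_hat d a n m = S1p_sum d a n m"
proof -
  have "(-1 :: rat) ^ (n - m) * (-1) ^ (n + m) = 1"
    using assms(2) by (simp flip: power_add)
  then show ?thesis
    using assms(1) by (simp add: S1p_hat_def S1_eq_S1_closed S1_closed_def flip: mult.assoc)
qed

theorem mainTheorem18:
  fixes d a n m :: nat
  assumes "d \<ge> 1" and "m \<le> n"
  shows "S1p_hat d a n m =
           (\<Sum>j=0..n - m. of_nat ((n - j) choose m) * of_nat (stirling n (n - j)) *
              of_nat a ^ (n - m - j) * of_nat d ^ j)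
       \<and> S1p_hat d a n m =
           (\<Sum>j=m..n. of_nat (j choose m) * of_nat (stirling n j) *
              of_nat a ^ (j - m) * of_nat d ^ (n - j))"
proof -
  have second: "S1p_hat d a n m =
      (\<Sum>j=m..n. of_nat (j choose m) * of_nat (stirling n j) * of_nat a ^ (j - m) * of_nat d ^ (n - j))"
    unfolding S1p_hat_eq_S1p_sum[OF assms] S1p_sum_def
    \<comment> \<open>The terms with \<open>j < m\<close> vanish because of the binomial
      coefficient.\<close>
    by (intro sum.mono_neutral_right) auto
  also have "\<dots> = (\<Sum>j=0..n - m. of_nat ((n - j) choose m) * of_nat (stirling n (n - j)) *
      of_nat a ^ (n - m - j) * of_nat d ^ j)"
    using assms(2)
    by (intro sum.reindex_bij_witness[of _ "\<lambda>j. n - j" "\<lambda>j. n - j"]) (auto simp: diff_right_commute)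
  finally show ?thesis
    using second by blast
qed

end
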